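(* Let $n,k$ be integers with $0<k<n/2$ and suppose the generalized Petersen graph $G(n,k)$ is not bipartite. Let $d:=\gcd(n,k)$ and let $a$ be the unique integer with $0<a<n/d$ such that $ak\equiv d \pmod n$. Then the following are equivalent: (a) $G(n,k)$ is a core; (b) some cycle of minimum odd length in $G(n,k)$ contains a spoke; (c) at least one of the following holds: (c.1) $n/d$ is even; (c.2) $a+d$ is even and $a\ge d+2$; (c.3) $a+d$ is odd and $a+d+2\le n/d$.
   Context: For integers $0<k<n/2$, the generalized Petersen graph $G(n,k)$ has vertex set $\{u_0,\dots,u_{n-1}\}\cup\{v_0,\dots,v_{n-1}\}$ (outer vertices $u_i$, inner vertices $v_i$) and edges $u_iu_{i+1}$ (outer rim), $v_iv_{i+k}$ (inner rims) and $u_iv_i$ (spokes), all indices modulo $n$. A graph is a core if every endomorphism (adjacency-preserving self-map of the vertex set) is an automorphism. *)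

theory Defs
  imports "Graph_Theory.Digraph_Component" "HOL-Number_Theory.Cong"
begin

text \<open>
  As in the Graph-Theory library, a finite simple graph is a \<^locale>\<open>pair_graph\<close>: an irreflexive,
  symmetric arc relation, in which every edge is represented by both of its orientations.
\<close>

definition bipartite :: "'a pair_pre_digraph \<Rightarrow> bool" where
  "bipartite G \<longleftrightarrow>
     (\<exists>A B. A \<union> B = pverts G \<and> A \<inter> B = {} \<and>
        (\<forall>(x, y) \<in> parcs G. x \<in> A \<and> y \<in> B \<or> x \<in> B \<and> y \<in> A))"

definition graph_endomorphism :: "'a pair_pre_digraph \<Rightarrow> ('a \<Rightarrow> 'a) \<Rightarrow> bool" where
  "graph_endomorphism G f \<longleftrightarrow>
     (\<forall>x \<in> pverts G. f x \<in> pverts G) \<and>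
     (\<forall>x y. (x, y) \<in> parcs G \<longrightarrow> (f x, f y) \<in> parcs G)"

definition graph_automorphism :: "'a pair_pre_digraph \<Rightarrow> ('a \<Rightarrow> 'a) \<Rightarrow> bool" where
  "graph_automorphism G f \<longleftrightarrow>
     bij_betw f (pverts G) (pverts G) \<and>
     (\<forall>x \<in> pverts G. \<forall>y \<in> pverts G. (x, y) \<in> parcs G \<longleftrightarrow> (f x, f y) \<in> parcs G)"

definition graph_core :: "'a pair_pre_digraph \<Rightarrow> bool" where
  "graph_core G \<longleftrightarrow> (\<forall>f. graph_endomorphism G f \<longrightarrow> graph_automorphism G f)"

text \<open>
  A cycle is given by its list of arcs, so its length is the length of that list.  The constant
  \<^const>\<open>pre_digraph.cycle\<close> also admits the degenerate closed walks \<open>x, y, x\<close>; these have even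
  length, so on a loop-free graph its cycles of odd length are those of the simple graph.
\<close>

definition shortest_odd_cycle :: "'a pair_pre_digraph \<Rightarrow> ('a \<times> 'a) list \<Rightarrow> bool" where
  "shortest_odd_cycle G p \<longleftrightarrow>
     pre_digraph.cycle (with_proj G) p \<and> odd (length p) \<and>
     (\<forall>q. pre_digraph.cycle (with_proj G) q \<and> odd (length q) \<longrightarrow> length p \<le> length q)"

datatype petersen_vertex = Outer nat | Inner nat

definition outer_rim :: "nat \<Rightarrow> petersen_vertex rel" where
  "outer_rim n = {(Outer i, Outer ((i + 1) mod n)) | i. i < n}"

definition inner_rims :: "nat \<Rightarrow> nat \<Rightarrow> petersen_vertex rel" where
  "inner_rims n k = {(Inner i, Inner ((i + k) mod n)) | i. i < n}"

definition spokes :: "nat \<Rightarrow> petersen_vertex rel" where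
  "spokes n = {(Outer i, Inner i) | i. i < n}"

definition generalized_petersen :: "nat \<Rightarrow> nat \<Rightarrow> petersen_vertex pair_pre_digraph" where
  "generalized_petersen n k =
     \<lparr> pverts = Outer ` {..<n} \<union> Inner ` {..<n},
       parcs = (let E = outer_rim n \<union> inner_rims n k \<union> spokes n in E \<union> E\<inverse>) \<rparr>"

definition contains_spoke :: "nat \<Rightarrow> (petersen_vertex \<times> petersen_vertex) list \<Rightarrow> bool" where
  "contains_spoke n p \<longleftrightarrow> set p \<inter> (spokes n \<union> (spokes n)\<inverse>) \<noteq> {}"

lemma mod_add_neq_self:
  fixes i j n :: nat
  assumes "i < n" "0 < j" "j < n"
  shows "(i + j) mod n \<noteq> i"
proof (cases "i + j < n")
  case True
  then show ?thesis using assms by simp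
next
  case False
  then have "(i + j) mod n = i + j - n" using assms by (simp add: mod_if)
  then show ?thesis using assms False by linarith
qed

lemma pair_graph_generalized_petersen:
  assumes "0 < k" "2 * k < n"
  shows "pair_graph (generalized_petersen n k)"
proof -
  let ?G = "generalized_petersen n k"
  let ?V = "Outer ` {..<n} \<union> Inner ` {..<n}"
  have sub: "parcs ?G \<subseteq> ?V \<times> ?V"
    using assms
    by (auto simp: generalized_petersen_def outer_rim_def inner_rims_def spokes_def Let_def)
  have V: "pverts ?G = ?V" by (simp add: generalized_petersen_def)
  have "Suc i mod n \<noteq> i" "(i + k) mod n \<noteq> i" if "i < n" for i
    using that mod_add_neq_self[of i n 1] mod_add_neq_self[of i n k] assms by simp_all
  then have irr: "fst e \<noteq> snd e" if "e \<in> parcs ?G" for e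
    using that
    by (fastforce simp: generalized_petersen_def outer_rim_def inner_rims_def spokes_def Let_def)
  have "sym (parcs ?G)"
    by (auto simp: generalized_petersen_def Let_def sym_def)
  moreover have "finite (parcs ?G)"
    by (rule finite_subset[OF sub]) auto
  ultimately show ?thesis
    using sub irr by unfold_locales (auto simp: V symmetric_def)
qed

text \<open>The multiplier \<open>a\<close> of the theorem exists and is unique.\<close>

lemma ex1_multiplier:
  fixes n k :: nat
  assumes "0 < k" "2 * k < n"
  shows "\<exists>!a. 0 < a \<and> a < n div gcd n k \<and> [a * k = gcd n k] (mod n)"
proof -
  define d where "d = gcd n k"
  define m where "m = n div d"
  define l where "l = k div d"
  have d0: "0 < d" using assms by (simp add: d_def)
  have n: "n = m * d" and k: "k = l * d" by (simp_all add: m_def l_def d_def)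
  have cop: "coprime l m"
    using div_gcd_coprime[of n k] assms by (simp add: l_def m_def d_def coprime_commute)
  have "l < m" "0 < l" "2 * l < m" using assms d0 unfolding n k by simp_all
  then have m2: "2 < m" by linarith
  have iff: "[a * k = d] (mod n) \<longleftrightarrow> [a * l = 1] (mod m)" for a
  proof -
    have "[a * k = d] (mod n) \<longleftrightarrow> (d * (a * l)) mod (d * m) = (d * 1) mod (d * m)"
      by (simp add: cong_def n k ac_simps)
    also have "\<dots> \<longleftrightarrow> [a * l = 1] (mod m)"
      unfolding mult_mod_right[symmetric] using d0 by (simp add: cong_def)
    finally show ?thesis .
  qed
  obtain b where b: "[l * b = 1] (mod m)"
    using cong_solve_coprime_nat[OF cop] by auto
  have ex: "[(b mod m) * l = 1] (mod m)"
    using b unfolding cong_def mod_mult_left_eq by (simp only: mult.commute)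
  have pos: "0 < b mod m"
  proof (rule ccontr)
    assume "\<not> 0 < b mod m"
    then show False using ex m2 by (simp add: cong_def)
  qed
  have uniq: "x = y" if "x < m" "y < m" "[x * l = 1] (mod m)" "[y * l = 1] (mod m)" for x y
  proof -
    have "[x * l = y * l] (mod m)" using that by (metis cong_sym cong_trans)
    then have "[x = y] (mod m)" using cop by (simp add: cong_mult_rcancel_nat)
    then show ?thesis using that by (simp add: cong_def)
  qed
  show ?thesis
    unfolding d_def[symmetric] m_def[symmetric] iff
    using ex pos uniq m2 by (intro ex1I[of _ "b mod m"]) auto
qed

end

theory Submission
  imports Defs
begin

text \<open>
  Put \<open>m = n / d\<close>. An odd closed walk with net displacement \<open>x\<close> along outer and \<open>y\<close> along inner edges
  satisfies \<open>x + k y \<equiv> 0 (mod n)\<close>, and its steps can be rearranged so that it uses at most two spokes.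

  If (c) fails, then \<open>m\<close> is odd and \<open>a\<close> is congruent modulo \<open>m\<close> to some \<open>A\<close> with \<open>\<bar>A\<bar> \<le> d\<close> of the
  parity of \<open>d\<close>. This yields a homomorphism onto an inner rim, and, since \<open>y + A x / d\<close> is then an
  odd multiple of \<open>m\<close>, every odd cycle through a spoke is longer than the inner rims.

  If (c) holds, some shortest odd closed walk makes \<open>\<bar>x\<bar> > 0\<close> outer steps, \<open>\<bar>y\<bar> > 0\<close> inner steps and
  crosses two spokes. An endomorphism cannot identify the ends of a path of length two on a shortest
  odd closed walk. By reflection and rotation this covers all such paths, except perhaps those within
  the rims of one sort if \<open>\<bar>x\<bar> = 1\<close> or \<open>\<bar>y\<bar> = 1\<close>. Some power of an endomorphism is idempotent, and
  where an idempotent endomorphism is locally injective, the neighbours of a fixed vertex are fixed.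
  Since its image cannot lie in the exceptional rims only, it is the identity.
\<close>

section \<open>Walks and endomorphisms\<close>

lemma cycle_of_closed_sequence:
  fixes c :: "nat \<Rightarrow> 'a"
  assumes "pair_wf_digraph G" "0 < L" "inj_on c {..<L}" "c L = c 0"
    and arcs: "\<And>i. i < L \<Longrightarrow> (c i, c (Suc i)) \<in> parcs G"
  shows "pre_digraph.cycle (with_proj G) (map (\<lambda>i. (c i, c (Suc i))) [0..<L])"
proof -
  let ?p = "\<lambda>a l. map (\<lambda>i. (c i, c (Suc i))) [a..<a + l]"
  have cas: "pcas (c a) (?p a l) (c (a + l))" for a l
    by (induction l arbitrary: a) (simp_all add: upt_conv_Cons del: upt_Suc flip: add_Suc)
  have verts: "pawalk_verts (c a) (?p a l) = map c [a..<Suc (a + l)]" for a l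
  proof (induction l arbitrary: a)
    case (Suc l)
    show ?case using Suc[of "Suc a"] by (simp add: upt_conv_Cons del: upt_Suc)
  qed simp
  \<comment> \<open>\<open>cycle\<close> asks for distinct vertices after the head of the vertex
    list; there index \<open>L\<close> stands in for index 0, which \<open>r\<close> undoes.\<close>
  have "inj_on c {1..L}"
  proof (rule inj_onI)
    fix i j assume ij: "i \<in> {1..L}" "j \<in> {1..L}" "c i = c j"
    define r where "r = (\<lambda>i. if i = L then 0 else i)"
    have "c (r i) = c (r j)" "r i < L" "r j < L"
      using ij assms(2,4) by (auto simp: r_def)
    then have "r i = r j" using assms(3) by (auto dest: inj_onD)
    then show "i = j" using ij by (auto simp: r_def split: if_splits)
  qed
  moreover have "set [1..<Suc L] = {1..L}" by auto
  ultimately have "distinct (map c [1..<Suc L])" by (simp add: distinct_map del: upt_Suc)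
  moreover have "tl (pawalk_verts (c 0) (?p 0 L)) = map c [1..<Suc L]"
    unfolding verts by (simp add: upt_conv_Cons del: upt_Suc)
  moreover have "c 0 \<in> pverts G"
    using arcs[of 0] assms(1,2) by (auto dest: pair_wf_digraph.in_arcsD1)
  moreover have "set (?p 0 L) \<subseteq> parcs G" using arcs by auto
  ultimately show ?thesis
    using cas[of 0 L] assms(2,4)
    by (auto simp: pre_digraph.cycle_def pre_digraph.awalk_def cas_with_proj_eq
        awalk_verts_with_proj_eq intro!: exI[of _ "c 0"])
qed

lemma pcas_append: "pcas u (p @ q) v \<longleftrightarrow> (\<exists>w. pcas u p w \<and> pcas w q v)"
  by (induction p arbitrary: u) auto

text \<open>Walks are handled below as relational powers: the exponent is the length, and vertices
  may repeat.\<close>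

lemma relpow_of_pcas: "pcas u p v \<Longrightarrow> set p \<subseteq> E \<Longrightarrow> (u, v) \<in> E ^^ length p"
proof (induction p arbitrary: u)
  case (Cons e p)
  then have "(u, snd e) \<in> E" "(snd e, v) \<in> E ^^ length p" by auto
  then show ?case using relpow_Suc_I2 by fastforce
qed simp

lemma relpow_of_cycle:
  assumes "pre_digraph.cycle (with_proj G) p"
  shows "\<exists>u. (u, u) \<in> parcs G ^^ length p"
  using assms relpow_of_pcas[of _ p _ "parcs G"]
  by (auto simp: pre_digraph.cycle_def pre_digraph.awalk_def cas_with_proj_eq)

text \<open>Rotate the cycle so that \<open>e\<close> comes first and drop it; the rest leads from
  the head of \<open>e\<close> back to its tail.\<close>

lemma relpow_of_cycle_through:
  assumes "pre_digraph.cycle (with_proj G) p" and e: "e \<in> set p"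
  shows "e \<in> parcs G \<and> (snd e, fst e) \<in> parcs G ^^ (length p - 1)"
proof -
  obtain u where u: "pcas u p u" "set p \<subseteq> parcs G"
    using assms(1) by (auto simp: pre_digraph.cycle_def pre_digraph.awalk_def cas_with_proj_eq)
  obtain p1 p2 where p: "p = p1 @ e # p2" using e by (meson split_list)
  have "pcas (snd e) (p2 @ p1) (fst e)"
    using u(1) by (auto simp: p pcas_append)
  from relpow_of_pcas[OF this, of "parcs G"] show ?thesis
    using u(2) by (simp add: p add.commute)
qed

lemma relpow_trans: "(u, v) \<in> R ^^ l \<Longrightarrow> (v, w) \<in> R ^^ l' \<Longrightarrow> (u, w) \<in> R ^^ (l + l')"
  by (auto simp: relpow_add)

lemma relpow_rev:
  assumes "sym R" "(u, v) \<in> R ^^ l"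
  shows "(v, u) \<in> R ^^ l"
  using assms(2)
proof (induction l arbitrary: v)
  case (Suc l)
  then obtain w where "(u, w) \<in> R ^^ l" "(w, v) \<in> R" by auto
  then show ?case using Suc.IH assms(1) by (meson relpow_Suc_I2 symD)
qed simp

section \<open>Endomorphisms and their idempotent powers\<close>

lemma endomorphism_relpow:
  assumes "graph_endomorphism G f" "(u, v) \<in> parcs G ^^ l"
  shows "(f u, f v) \<in> parcs G ^^ l"
  using assms(2)
proof (induction l arbitrary: v)
  case (Suc l)
  then obtain w where "(u, w) \<in> parcs G ^^ l" "(w, v) \<in> parcs G" by auto
  then show ?case
    using Suc.IH assms(1) by (meson graph_endomorphism_def relpow_Suc_I)
qed simp

lemma endomorphism_funpow:
  assumes "graph_endomorphism G f"
  shows "graph_endomorphism G (f ^^ N)"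
  by (induction N) (use assms in \<open>auto simp: graph_endomorphism_def\<close>)

text \<open>Pigeonhole: two powers \<open>i < j\<close> agree on \<open>V\<close>, so from
  \<open>i\<close> on the powers have period \<open>r = j - i\<close>. The exponent
  \<open>i * r\<close> is at least \<open>i\<close> and a multiple of \<open>r\<close>, so doubling
  it changes nothing.\<close>

lemma ex_idempotent_funpow:
  assumes "finite V" "\<And>x. x \<in> V \<Longrightarrow> f x \<in> V"
  shows "\<exists>N>0. \<forall>x\<in>V. (f ^^ N) ((f ^^ N) x) = (f ^^ N) x"
proof -
  have mem: "(f ^^ i) x \<in> V" if "x \<in> V" for i x
    by (induction i) (use that assms(2) in auto)
  \<comment> \<open>Restricting to \<open>V\<close> puts the powers into a finite function space;
    \<open>Suc\<close> makes the exponents, and later \<open>i * r\<close>, positive.\<close>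
  let ?r = "\<lambda>i. restrict (f ^^ Suc i) V"
  have "range ?r \<subseteq> V \<rightarrow>\<^sub>E V"
    using mem[of _ "Suc _"] by (auto simp: PiE_iff simp del: funpow.simps)
  moreover have "finite (V \<rightarrow>\<^sub>E V)" using assms(1) by (intro finite_PiE) auto
  ultimately have "\<not> inj ?r" using finite_subset finite_imageD infinite_UNIV_nat by blast
  then obtain i' j' where "i' < j'" "?r i' = ?r j'"
    unfolding inj_def by (metis nat_neq_iff)
  then obtain i j where ij: "0 < i" "i < j" "restrict (f ^^ i) V = restrict (f ^^ j) V"
    by (metis Suc_mono zero_less_Suc)
  define r where "r = j - i"
  have eq: "(f ^^ i) x = (f ^^ (i + r)) x" if "x \<in> V" for x
    using fun_cong[OF ij(3), of x] that ij(2) by (simp add: r_def)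
  have step: "(f ^^ (l + r)) x = (f ^^ l) x" if "i \<le> l" "x \<in> V" for l x
  proof -
    have l: "l = (l - i) + i" "l + r = (l - i) + (i + r)" using that by auto
    show ?thesis
      by (subst l(1), subst l(2)) (simp only: funpow_add o_apply eq[OF that(2)])
  qed
  have steps: "(f ^^ (l + q * r)) x = (f ^^ l) x" if "i \<le> l" "x \<in> V" for l q x
  proof (induction q)
    case (Suc q)
    show ?case using step[of "l + q * r" x] that Suc by (simp add: algebra_simps)
  qed simp
  have r: "0 < r" "i \<le> i * r" using ij by (auto simp: r_def)
  have "(f ^^ (i * r)) ((f ^^ (i * r)) x) = (f ^^ (i * r)) x" if "x \<in> V" for x
    using steps[OF r(2) that, of i] by (simp add: funpow_add)
  then show ?thesis using r ij(1) by (intro exI[of _ "i * r"]) auto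
qed

text \<open>Once the idempotent power \<open>f ^^ N\<close> is the identity on the vertices,
  \<open>f ^^ (N - 1)\<close> is an endomorphism inverting \<open>f\<close> there, so
  \<open>f\<close> is bijective and reflects adjacency.\<close>

lemma core_if_idempotents_trivial:
  assumes "pair_graph G"
    and triv: "\<And>f. graph_endomorphism G f \<Longrightarrow> \<forall>x\<in>pverts G. f (f x) = f x
      \<Longrightarrow> \<forall>x\<in>pverts G. f x = x"
  shows "graph_core G"
  unfolding graph_core_def
proof (intro allI impI)
  fix f assume f: "graph_endomorphism G f"
  have fin: "finite (pverts G)"
    using assms(1) by (simp add: pair_graph_def pair_digraph_def pair_fin_digraph.pair_finite_verts)
  have V: "f x \<in> pverts G" if "x \<in> pverts G" for x
    using f that by (auto simp: graph_endomorphism_def)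
  obtain N where N: "0 < N" "\<forall>x\<in>pverts G. (f ^^ N) ((f ^^ N) x) = (f ^^ N) x"
    using ex_idempotent_funpow[of "pverts G" f, OF fin V] by auto
  have id: "(f ^^ N) x = x" if "x \<in> pverts G" for x
    using triv[of "f ^^ N", OF endomorphism_funpow[OF f] N(2)] that by simp
  obtain N' where N': "N = Suc N'" using N(1) gr0_implies_Suc by blast
  define h where "h = f ^^ N'"
  have h: "h (f x) = x" if "x \<in> pverts G" for x
    using id[OF that] by (simp add: h_def N' funpow_swap1)
  have "inj_on f (pverts G)" by (metis h inj_onI)
  then have "bij_betw f (pverts G) (pverts G)"
    using fin V by (simp add: bij_betw_def endo_inj_surj image_subset_iff)
  moreover have "graph_endomorphism G h" unfolding h_def by (rule endomorphism_funpow[OF f])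
  then have "(x, y) \<in> parcs G \<longleftrightarrow> (f x, f y) \<in> parcs G"
    if "x \<in> pverts G" "y \<in> pverts G" for x y
    using f h that unfolding graph_endomorphism_def by metis
  ultimately show "graph_automorphism G f" by (simp add: graph_automorphism_def)
qed

section \<open>Generalized Petersen graphs with integer indices\<close>

text \<open>With integer indices both directions of travel are translations; with a boolean sort,
  negation exchanges outer and inner vertices.\<close>

definition vtx :: "nat \<Rightarrow> bool \<Rightarrow> int \<Rightarrow> petersen_vertex" where
  "vtx n b i = (if b then Outer else Inner) (nat (i mod int n))"

definition step :: "nat \<Rightarrow> bool \<Rightarrow> int" where
  "step k b = (if b then 1 else int k)"

lemma vtx_eq_iff:
  assumes "0 < n"
  shows "vtx n b i = vtx n c j \<longleftrightarrow> b = c \<and> [i = j] (mod int n)"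
proof -
  have "nat (i mod int n) = nat (j mod int n) \<longleftrightarrow> i mod int n = j mod int n"
    using assms by (simp add: eq_nat_nat_iff)
  then show ?thesis by (auto simp: vtx_def cong_def)
qed

lemma vtx_cong: "[i = j] (mod int n) \<Longrightarrow> vtx n b i = vtx n b j"
  by (simp add: vtx_def cong_def)

lemma vtx_of_nat: "i < n \<Longrightarrow> vtx n True (int i) = Outer i" "i < n \<Longrightarrow> vtx n False (int i) = Inner i"
  by (simp_all add: vtx_def)

lemma pverts_petersen_iff:
  assumes "0 < n"
  shows "v \<in> pverts (generalized_petersen n k) \<longleftrightarrow> (\<exists>b i. v = vtx n b i)"
proof
  assume "v \<in> pverts (generalized_petersen n k)"
  then obtain i where "i < n" "v = Outer i \<or> v = Inner i"
    by (auto simp: generalized_petersen_def)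
  then show "\<exists>b i. v = vtx n b i" by (metis vtx_of_nat)
next
  assume "\<exists>b i. v = vtx n b i"
  then obtain b i where "v = vtx n b i" by blast
  moreover have "nat (i mod int n) < n"
    using assms pos_mod_bound[of "int n" i] pos_mod_sign[of "int n" i] by linarith
  ultimately show "v \<in> pverts (generalized_petersen n k)"
    by (auto simp: vtx_def generalized_petersen_def)
qed

lemma sym_parcs_petersen: "sym (parcs (generalized_petersen n k))"
  by (auto simp: generalized_petersen_def Let_def sym_def)

lemma forward_arcs:
  assumes "0 < n"
  shows "outer_rim n = {(vtx n True i, vtx n True (i + 1)) | i. True}"
    and "inner_rims n k = {(vtx n False i, vtx n False (i + int k)) | i. True}"
    and "spokes n = {(vtx n True i, vtx n False i) | i. True}"
proof -
  have ex: "(\<exists>i. P (nat (i mod int n))) \<longleftrightarrow> (\<exists>i<n. P i)" for P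
  proof
    assume "\<exists>i. P (nat (i mod int n))"
    moreover have "nat (i mod int n) < n" for i
      using assms pos_mod_bound[of "int n" i] pos_mod_sign[of "int n" i] by linarith
    ultimately show "\<exists>i<n. P i" by blast
  next
    assume "\<exists>i<n. P i"
    then obtain i where "i < n" "P i" by blast
    then have "P (nat (int i mod int n))" by simp
    then show "\<exists>i. P (nat (i mod int n))" by blast
  qed
  have add: "nat ((i + int j) mod int n) = (nat (i mod int n) + j) mod n" for i j
  proof -
    have "(i + int j) mod int n = int ((nat (i mod int n) + j) mod n)"
      using assms by (simp add: zmod_int mod_add_left_eq)
    then show ?thesis by simp
  qed
  have "e \<in> outer_rim n \<longleftrightarrow> e \<in> {(vtx n True i, vtx n True (i + 1)) | i. True}" for e
    using ex[of "\<lambda>i. e = (Outer i, Outer ((i + 1) mod n))"] add[of _ 1]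
    by (auto simp: outer_rim_def vtx_def)
  then show "outer_rim n = {(vtx n True i, vtx n True (i + 1)) | i. True}" by blast
  have "e \<in> inner_rims n k \<longleftrightarrow> e \<in> {(vtx n False i, vtx n False (i + int k)) | i. True}" for e
    using ex[of "\<lambda>i. e = (Inner i, Inner ((i + k) mod n))"] add[of _ k]
    by (auto simp: inner_rims_def vtx_def)
  then show "inner_rims n k = {(vtx n False i, vtx n False (i + int k)) | i. True}" by blast
  have "e \<in> spokes n \<longleftrightarrow> e \<in> {(vtx n True i, vtx n False i) | i. True}" for e
    using ex[of "\<lambda>i. e = (Outer i, Inner i)"]
    by (auto simp: spokes_def vtx_def)
  then show "spokes n = {(vtx n True i, vtx n False i) | i. True}" by blast
qed

lemma arc_petersen_iff:
  assumes "0 < n"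
  shows "(vtx n b i, w) \<in> parcs (generalized_petersen n k) \<longleftrightarrow>
    w = vtx n b (i + step k b) \<or> w = vtx n b (i - step k b) \<or> w = vtx n (\<not> b) i"
proof -
  have eq: "(\<exists>j. vtx n b i = vtx n b (j + z) \<and> w = vtx n b j) \<longleftrightarrow> w = vtx n b (i - z)" for z
  proof
    assume "\<exists>j. vtx n b i = vtx n b (j + z) \<and> w = vtx n b j"
    then obtain j where j: "[i = j + z] (mod int n)" "w = vtx n b j"
      using vtx_eq_iff[OF assms] by auto
    have "[i - z = j] (mod int n)" using cong_diff[OF j(1) cong_refl[of z]] by simp
    with j(2) show "w = vtx n b (i - z)" by (simp add: vtx_cong)
  next
    assume "w = vtx n b (i - z)"
    then show "\<exists>j. vtx n b i = vtx n b (j + z) \<and> w = vtx n b j"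
      by (intro exI[of _ "i - z"]) simp
  qed
  have eq2: "(\<exists>j. vtx n b i = vtx n b j \<and> w = vtx n c (j + z)) \<longleftrightarrow> w = vtx n c (i + z)" for z c
  proof
    assume "\<exists>j. vtx n b i = vtx n b j \<and> w = vtx n c (j + z)"
    then obtain j where j: "[i = j] (mod int n)" "w = vtx n c (j + z)"
      using vtx_eq_iff[OF assms] by auto
    show "w = vtx n c (i + z)"
      unfolding j(2) by (rule vtx_cong[OF cong_add[OF cong_sym[OF j(1)] cong_refl]])
  qed blast
  have eq3: "(\<exists>j. vtx n b i = vtx n b j \<and> w = vtx n c j) \<longleftrightarrow> w = vtx n c i" for c
    using eq2[of c 0] by simp
  show ?thesis
    using eq[of "step k b"] eq2[of b "step k b"] eq3[of "\<not> b"]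
    by (cases b) (auto simp: generalized_petersen_def Let_def forward_arcs[OF assms] step_def
        vtx_eq_iff[OF assms])
qed

lemma pair_wf_petersen:
  assumes "0 < k" "2 * k < n"
  shows "pair_wf_digraph (generalized_petersen n k)"
  using pair_graph_generalized_petersen[OF assms]
  by (simp add: pair_graph_def pair_digraph_def pair_fin_digraph_def)

text \<open>The integers \<open>x\<close> and \<open>y\<close> are the net displacements along outer and inner edges,
  and \<open>t\<close> is the number of spokes.\<close>

lemma net_displacement:
  assumes "0 < n" "(vtx n b i, v) \<in> parcs (generalized_petersen n k) ^^ l"
  shows "\<exists>c x y t. v = vtx n c (i + x + int k * y) \<and> \<bar>x\<bar> + \<bar>y\<bar> + int t \<le> int l
    \<and> even (x + y + int t + int l) \<and> (even t \<longleftrightarrow> b = c) \<and> (t = 0 \<longrightarrow> (if b then y = 0 else x = 0))"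
  using assms(2)
proof (induction l arbitrary: v)
  case 0
  then show ?case by (intro exI[of _ b] exI[of _ 0]) auto
next
  case (Suc l)
  then obtain u where u: "(vtx n b i, u) \<in> parcs (generalized_petersen n k) ^^ l"
    "(u, v) \<in> parcs (generalized_petersen n k)" by auto
  obtain c x y t where IH: "u = vtx n c (i + x + int k * y)" "\<bar>x\<bar> + \<bar>y\<bar> + int t \<le> int l"
    "even (x + y + int t + int l)" "even t \<longleftrightarrow> b = c" "t = 0 \<longrightarrow> (if b then y = 0 else x = 0)"
    using Suc.IH[OF u(1)] by blast
  have "v = vtx n c (i + x + int k * y + step k c) \<or> v = vtx n c (i + x + int k * y - step k c)
    \<or> v = vtx n (\<not> c) (i + x + int k * y)"
    using u(2) unfolding IH(1) arc_petersen_iff[OF assms(1)] .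
  then obtain e where e: "e = 1 \<or> e = - 1" and
    v: "v = vtx n c (i + x + int k * y + e * step k c) \<or> v = vtx n (\<not> c) (i + x + int k * y)"
    by (metis add_uminus_conv_diff mult_1 mult_minus1)
  show ?case
  proof (cases "v = vtx n (\<not> c) (i + x + int k * y)")
    case True
    show ?thesis
      by (rule exI[of _ "\<not> c"], rule exI[of _ x], rule exI[of _ y], rule exI[of _ "Suc t"])
        (use True IH in auto)
  next
    case False
    then have v: "v = vtx n c (i + x + int k * y + e * step k c)" using v by simp
    show ?thesis
    proof (cases c)
      case True
      show ?thesis
        by (rule exI[of _ c], rule exI[of _ "x + e"], rule exI[of _ y], rule exI[of _ t])
          (use True IH e v in \<open>auto simp: step_def algebra_simps\<close>)
    next
      case False
      show ?thesis
        by (rule exI[of _ c], rule exI[of _ x], rule exI[of _ "y + e"], rule exI[of _ t])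
          (use False IH e v in \<open>auto simp: step_def algebra_simps\<close>)
    qed
  qed
qed

text \<open>The sorts may differ because deleting a spoke from a cycle leaves a walk between two
  vertices of equal index.\<close>

lemma closed_net_displacement:
  assumes "0 < n" "(vtx n b i, vtx n c i) \<in> parcs (generalized_petersen n k) ^^ l"
  shows "\<exists>x y t. [x + int k * y = 0] (mod int n) \<and> \<bar>x\<bar> + \<bar>y\<bar> + int t \<le> int l
    \<and> even (x + y + int t + int l) \<and> (even t \<longleftrightarrow> b = c) \<and> (t = 0 \<longrightarrow> (if b then y = 0 else x = 0))"
proof -
  obtain c' x y t where v: "vtx n c i = vtx n c' (i + x + int k * y)"
    and *: "\<bar>x\<bar> + \<bar>y\<bar> + int t \<le> int l" "even (x + y + int t + int l)" "even t \<longleftrightarrow> b = c'"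
      "t = 0 \<longrightarrow> (if b then y = 0 else x = 0)"
    using net_displacement[OF assms] by blast
  from v have c': "c' = c" and "int n dvd i - (i + x + int k * y)"
    by (auto simp: vtx_eq_iff[OF assms(1)] cong_iff_dvd_diff)
  moreover have "i - (i + x + int k * y) = - (x + int k * y)" by simp
  ultimately have "[x + int k * y = 0] (mod int n)" by (simp only: cong_0_iff dvd_minus_iff)
  with * show ?thesis unfolding c' by blast
qed

section \<open>Shortest odd cycles through a spoke\<close>

lemma cong_if_diff_multiple:
  fixes a b c p m :: int
  assumes "[p = 0] (mod m)" "a - b = c * p"
  shows "[a = b] (mod m)"
  using assms by (simp add: cong_iff_dvd_diff)

text \<open>A shortest odd closed walk with exactly two spokes, making \<open>x True\<close> outer and \<open>x False\<close>
  inner steps; the signs in \<open>s\<close> are its directions of travel.\<close>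

locale minimal_spoke_walk =
  fixes n k :: nat and s :: "bool \<Rightarrow> int" and x :: "bool \<Rightarrow> nat"
  assumes k: "0 < k" "2 * k < n"
    and s: "s b = step k b \<or> s b = - step k b"
    and x: "0 < x b"
    and closed_True: "[int (x True) * s True + int (x False) * s False = 0] (mod int n)"
    and odd_True: "odd (x True + x False)"
    and minimal_True: "odd l \<Longrightarrow> (v, v) \<in> parcs (generalized_petersen n k) ^^ l
      \<Longrightarrow> x True + x False + 2 \<le> l"
begin

abbreviation "E \<equiv> parcs (generalized_petersen n k)"
abbreviation "V \<equiv> pverts (generalized_petersen n k)"

lemma n: "0 < n"
  using k by simp

text \<open>Symmetric in \<open>b\<close> and \<open>\<not> b\<close>, so that each later argument
  serves both sorts.\<close>

lemma closed: "[int (x b) * s b + int (x (\<not> b)) * s (\<not> b) = 0] (mod int n)"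
  using closed_True by (cases b) (simp_all add: add.commute)

lemma odd_length: "odd (x b + x (\<not> b))"
  using odd_True by (cases b) (simp_all add: add.commute)

lemma minimal: "odd l \<Longrightarrow> (v, v) \<in> E ^^ l \<Longrightarrow> x b + x (\<not> b) + 2 \<le> l"
  using minimal_True[of l v] by (cases b) (simp_all add: add.commute)

lemma arc_iff:
  "(vtx n b i, w) \<in> E \<longleftrightarrow> w = vtx n b (i + s b) \<or> w = vtx n b (i - s b) \<or> w = vtx n (\<not> b) i"
  using s[of b] by (auto simp: arc_petersen_iff[OF n])

lemma rim_walk:
  assumes "e = 1 \<or> e = - 1"
  shows "(vtx n b i, vtx n b (i + e * int j * s b)) \<in> E ^^ j"
proof (induction j)
  case (Suc j)
  have "(vtx n b (i + e * int j * s b), vtx n b (i + e * int j * s b + e * s b)) \<in> E"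
    using assms by (auto simp: arc_iff)
  moreover have "i + e * int j * s b + e * s b = i + e * int (Suc j) * s b"
    by (simp add: algebra_simps)
  ultimately have "(vtx n b (i + e * int j * s b), vtx n b (i + e * int (Suc j) * s b)) \<in> E"
    by (simp only:)
  then show ?case using Suc by auto
qed simp

lemma rim_walk_to:
  assumes "e = 1 \<or> e = - 1" "[i' = i + e * int j * s b] (mod int n)"
  shows "(vtx n b i, vtx n b i') \<in> E ^^ j"
  unfolding vtx_cong[OF assms(2)] by (rule rim_walk[OF assms(1)])

lemma spoke_walk:
  assumes "[i' = i] (mod int n)"
  shows "(vtx n b i, vtx n (\<not> b) i') \<in> E ^^ 1"
  unfolding vtx_cong[OF assms] by (simp add: arc_iff)

lemma closed_shift:
  assumes "e = 1 \<or> e = - 1"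
  shows "[i = i + e * int (x b) * s b + e * int (x (\<not> b)) * s (\<not> b)] (mod int n)"
  by (rule cong_if_diff_multiple[OF closed[of b], where c = "- e"]) (simp add: algebra_simps)

text \<open>The closed walk makes \<open>x b\<close> rim steps, a spoke, \<open>x (\<not> b)\<close>
  rim steps and a spoke. Its first step and last spoke meet in a corner; this is the rest. Taking
  \<open>e = - 1\<close> reflects the walk.\<close>

lemma corner_walk:
  assumes e: "e = 1 \<or> e = - 1"
  shows "(vtx n b (i + e * s b), vtx n (\<not> b) i) \<in> E ^^ (x b + x (\<not> b))"
proof -
  let ?m = "i + e * int (x b) * s b"
  have "i + e * s b + e * int (x b - 1) * s b = ?m"
    using x[of b] by (simp add: of_nat_diff algebra_simps)
  then have "(vtx n b (i + e * s b), vtx n b ?m) \<in> E ^^ (x b - 1)"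
    using rim_walk[OF e, of b "i + e * s b" "x b - 1"] by (simp only:)
  moreover have "(vtx n b ?m, vtx n (\<not> b) ?m) \<in> E ^^ 1"
    by (rule spoke_walk) simp
  moreover have "(vtx n (\<not> b) ?m, vtx n (\<not> b) i) \<in> E ^^ x (\<not> b)"
    by (rule rim_walk_to[OF e closed_shift[OF e]])
  ultimately have "(vtx n b (i + e * s b), vtx n (\<not> b) i) \<in> E ^^ (x b - 1 + 1 + x (\<not> b))"
    by (meson relpow_trans)
  then show ?thesis using x[of b] by simp
qed

text \<open>On a straight rim, every path with three vertices is part of a shortest odd closed walk, so
  no endomorphism folds it.\<close>

definition straight :: "bool \<Rightarrow> bool" where
  "straight b \<longleftrightarrow> (\<forall>i. (vtx n b (i + s b), vtx n b (i - s b)) \<in> E ^^ (x b + x (\<not> b)))"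

text \<open>Translate the closed walk so that two of its steps on sort \<open>b\<close> are centred
  at index \<open>i\<close>, and remove them.\<close>

lemma straight_if_two_steps:
  assumes "2 \<le> x b"
  shows "straight b"
  unfolding straight_def
proof
  fix i
  let ?m = "i + int (x b - 1) * s b"
  have "i + s b + 1 * int (x b - 2) * s b = ?m"
    using assms by (simp add: of_nat_diff algebra_simps)
  then have "(vtx n b (i + s b), vtx n b ?m) \<in> E ^^ (x b - 2)"
    using rim_walk[of 1 b "i + s b" "x b - 2"] by (simp only: simp_thms)
  moreover have "(vtx n b ?m, vtx n (\<not> b) ?m) \<in> E ^^ 1"
    by (rule spoke_walk) simp
  moreover have "(vtx n (\<not> b) ?m, vtx n (\<not> b) (i - s b)) \<in> E ^^ x (\<not> b)"
  proof (rule rim_walk_to)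
    show "[i - s b = ?m + 1 * int (x (\<not> b)) * s (\<not> b)] (mod int n)"
      by (rule cong_if_diff_multiple[OF closed[of b], where c = "- 1"])
        (use assms in \<open>simp add: of_nat_diff algebra_simps\<close>)
  qed simp
  moreover have "(vtx n (\<not> b) (i - s b), vtx n b (i - s b)) \<in> E ^^ 1"
    using spoke_walk[of "i - s b" "i - s b" "\<not> b"] by simp
  ultimately have "(vtx n b (i + s b), vtx n b (i - s b)) \<in> E ^^ (x b - 2 + 1 + x (\<not> b) + 1)"
    by (meson relpow_trans)
  moreover have "x b - 2 + 1 + x (\<not> b) + 1 = x b + x (\<not> b)" using assms by simp
  ultimately show "(vtx n b (i + s b), vtx n b (i - s b)) \<in> E ^^ (x b + x (\<not> b))"
    by (simp only:)
qed

text \<open>Identifying the ends would turn the image into an odd closed walk two shorter than the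
  minimum.\<close>

lemma not_identified:
  assumes "graph_endomorphism (generalized_petersen n k) f" "(u, v) \<in> E ^^ (x b + x (\<not> b))"
  shows "f u \<noteq> f v"
proof
  assume "f u = f v"
  then have "(f u, f u) \<in> E ^^ (x b + x (\<not> b))"
    using endomorphism_relpow[OF assms] by simp
  then show False using minimal[OF odd_length[of b], of "f u" b] by simp
qed

text \<open>Two of the three pairs of neighbours involve the spoke and form corners; the third lies
  on the rim, where straightness is needed.\<close>

lemma neighbours_walk:
  assumes "straight b" "(vtx n b i, u) \<in> E" "(vtx n b i, v) \<in> E" "u \<noteq> v"
  shows "(u, v) \<in> E ^^ (x b + x (\<not> b))"
proof -
  have corner: "(vtx n b (i + s b), vtx n (\<not> b) i) \<in> E ^^ (x b + x (\<not> b))"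
    "(vtx n b (i - s b), vtx n (\<not> b) i) \<in> E ^^ (x b + x (\<not> b))"
    using corner_walk[of 1 b i] corner_walk[of "-1" b i] by simp_all
  have str: "(vtx n b (i + s b), vtx n b (i - s b)) \<in> E ^^ (x b + x (\<not> b))"
    using assms(1) by (simp add: straight_def)
  note walks = corner str
  note rev_walks = walks[THEN relpow_rev[OF sym_parcs_petersen]]
  show ?thesis using assms(2-4) walks rev_walks unfolding arc_iff by metis
qed

text \<open>Both \<open>v\<close> and \<open>f v\<close> are neighbours of the fixed vertex, and
  idempotence gives them the same image, so they coincide.\<close>

lemma neighbours_fixed:
  assumes f: "graph_endomorphism (generalized_petersen n k) f"
    and idem: "\<forall>v\<in>V. f (f v) = f v"
    and b: "straight b" and fixd: "f (vtx n b i) = vtx n b i" and arc: "(vtx n b i, v) \<in> E"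
  shows "f v = v"
proof (rule ccontr)
  assume "f v \<noteq> v"
  have "(vtx n b i, f v) \<in> E"
    using f arc fixd unfolding graph_endomorphism_def by metis
  then have "f (f v) \<noteq> f v"
    using not_identified[OF f neighbours_walk[OF b _ arc \<open>f v \<noteq> v\<close>]] by blast
  moreover have "v \<in> V" using arc unfolding arc_iff pverts_petersen_iff[OF n] by blast
  ultimately show False using idem by blast
qed

text \<open>Connectedness as an induction principle: the outer rim reaches every index, and a spoke
  changes the sort.\<close>

lemma connected:
  assumes start: "vtx n b i \<in> U"
    and nbrs: "\<And>c j v. vtx n c j \<in> U \<Longrightarrow> (vtx n c j, v) \<in> E \<Longrightarrow> v \<in> U"
  shows "vtx n c j \<in> U"
proof -
  have switch: "vtx n c j \<in> U" if "vtx n b j \<in> U" for b c j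
    using that nbrs[OF that, of "vtx n (\<not> b) j"] by (cases "b = c") (auto simp: arc_iff)
  have "vtx n True (i + l) \<in> U" for l
  proof (induction l rule: int_induct[where k = 0])
    case base
    show ?case using switch[OF start] by simp
  next
    case (step1 l)
    then show ?case using nbrs[of True "i + l" "vtx n True (i + (l + 1))"]
      by (simp add: arc_petersen_iff[OF n] step_def algebra_simps)
  next
    case (step2 l)
    then show ?case using nbrs[of True "i + l" "vtx n True (i + (l - 1))"]
      by (simp add: arc_petersen_iff[OF n] step_def algebra_simps)
  qed
  from switch[OF this[of "j - i"]] show ?thesis by simp
qed

text \<open>Only sort \<open>b\<close> is known to be straight, so fixedness travels along the rim
  of sort \<open>b\<close> and then across its spokes. Since \<open>x (\<not> b) = 1\<close>, the
  closing relation makes \<open>s (\<not> b)\<close> a multiple of \<open>s b\<close> modulo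
  \<open>n\<close>, so these vertices are already all vertices.\<close>

lemma fixed_vertex_spreads:
  assumes f: "graph_endomorphism (generalized_petersen n k) f"
    and idem: "\<forall>v\<in>V. f (f v) = f v"
    and b: "straight b" and x': "x (\<not> b) = 1" and fixd: "f (vtx n b i) = vtx n b i"
  shows "f (vtx n c j) = vtx n c j"
proof -
  have on_b: "f (vtx n b (i + l * s b)) = vtx n b (i + l * s b)" for l
  proof (induction l rule: int_induct[where k = 0])
    case base
    show ?case using fixd by simp
  next
    case (step1 l)
    show ?case
      by (rule neighbours_fixed[OF f idem b step1(2)]) (simp add: arc_iff algebra_simps)
  next
    case (step2 l)
    show ?case
      by (rule neighbours_fixed[OF f idem b step2(2)]) (simp add: arc_iff algebra_simps)
  qed
  have on_c: "f (vtx n (\<not> b) (i + l * s b)) = vtx n (\<not> b) (i + l * s b)" for l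
    by (rule neighbours_fixed[OF f idem b on_b]) (auto simp: arc_iff)
  let ?U = "{vtx n c (i + l * s b) | c l. True}"
  have "vtx n c j \<in> ?U"
  proof (rule connected)
    have "vtx n b i = vtx n b (i + 0 * s b)" by simp
    then show "vtx n b i \<in> ?U" by blast
  next
    fix c j v assume "vtx n c j \<in> ?U" and arc: "(vtx n c j, v) \<in> E"
    then obtain l where "vtx n c j = vtx n c (i + l * s b)"
      using vtx_eq_iff[OF n] by auto
    then have v: "v = vtx n c (i + l * s b + s c) \<or> v = vtx n c (i + l * s b - s c)
      \<or> v = vtx n (\<not> c) (i + l * s b)"
      using arc arc_iff by metis
    show "v \<in> ?U"
    proof (cases "c = b")
      case True
      then have "v = vtx n b (i + (l + 1) * s b) \<or> v = vtx n b (i + (l - 1) * s b)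
        \<or> v = vtx n (\<not> b) (i + l * s b)"
        using v by (simp add: algebra_simps)
      then show ?thesis by blast
    next
      case False
      then have c: "c = (\<not> b)" by simp
      have "vtx n c (i + l * s b + s c) = vtx n c (i + (l - int (x b)) * s b)"
        by (rule vtx_cong, rule cong_if_diff_multiple[OF closed[of b], where c = 1])
          (simp add: c x' algebra_simps)
      moreover have "vtx n c (i + l * s b - s c) = vtx n c (i + (l + int (x b)) * s b)"
        by (rule vtx_cong, rule cong_if_diff_multiple[OF closed[of b], where c = "- 1"])
          (simp add: c x' algebra_simps)
      ultimately show ?thesis using v by auto
    qed
  qed
  then obtain l where "vtx n c j = vtx n c (i + l * s b)"
    using vtx_eq_iff[OF n] by auto
  then show ?thesis using on_b[of l] on_c[of l] by (cases "c = b") auto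
qed

text \<open>Otherwise the image of \<open>f\<close> lies in the rims of sort \<open>c\<close> and contains a closed walk of the
  minimal odd length. That walk runs around a rim in one direction, which makes \<open>c\<close> straight.\<close>

lemma image_meets_both_sorts:
  assumes f: "graph_endomorphism (generalized_petersen n k) f"
    and c: "\<not> straight c"
  shows "\<exists>v i. v \<in> V \<and> f v = vtx n (\<not> c) i"
proof (rule ccontr)
  assume none: "\<nexists>v i. v \<in> V \<and> f v = vtx n (\<not> c) i"
  have image: "\<exists>j. f v = vtx n c j" if "v \<in> V" for v
  proof -
    have "f v \<in> V" using f that by (simp add: graph_endomorphism_def)
    then obtain b j where "f v = vtx n b j" using pverts_petersen_iff[OF n] by blast
    then show ?thesis using none that by (cases "b = c") auto
  qed
  have inV: "vtx n b j \<in> V" for b j using pverts_petersen_iff[OF n] by blast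
  define u where "u = vtx n True 0"
  obtain i where i: "f u = vtx n c i" using image[OF inV] unfolding u_def by blast
  \<comment> \<open>The image never uses a spoke, so it is described by its signed number
    \<open>e\<close> of rim steps.\<close>
  have net: "\<exists>e. \<bar>e\<bar> \<le> int l \<and> even (e + int l) \<and> f v = vtx n c (i + e * s c)"
    if "(u, v) \<in> E ^^ l" for l v
    using that
  proof (induction l arbitrary: v)
    case 0
    then show ?case using i by (intro exI[of _ 0]) simp
  next
    case (Suc l)
    then obtain w where w: "(u, w) \<in> E ^^ l" "(w, v) \<in> E" by auto
    obtain e where e: "\<bar>e\<bar> \<le> int l" "even (e + int l)" "f w = vtx n c (i + e * s c)"
      using Suc.IH[OF w(1)] by blast
    have "(f w, f v) \<in> E" using f w(2) by (simp add: graph_endomorphism_def)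
    moreover have "v \<in> V"
      using pair_wf_digraph.in_arcsD2[OF pair_wf_petersen[OF k] w(2)] .
    then have "f v \<noteq> vtx n (\<not> c) j" for j using none by blast
    ultimately have "f v = vtx n c (i + e * s c + s c) \<or> f v = vtx n c (i + e * s c - s c)"
      unfolding e(3) arc_iff by blast
    then have "f v = vtx n c (i + (e + 1) * s c) \<or> f v = vtx n c (i + (e - 1) * s c)"
      by (simp add: algebra_simps)
    then show ?case
    proof
      assume "f v = vtx n c (i + (e + 1) * s c)"
      with e show ?thesis by (intro exI[of _ "e + 1"]) auto
    next
      assume "f v = vtx n c (i + (e - 1) * s c)"
      with e show ?thesis by (intro exI[of _ "e - 1"]) auto
    qed
  qed
  \<comment> \<open>The minimal odd length, attained below by a closed walk at \<open>u\<close>: one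
    step, the corner walk, and a spoke.\<close>
  let ?g = "x c + x (\<not> c) + 2"
  have "(vtx n True 0, vtx n True (0 + 1 * s True)) \<in> E ^^ 1"
    using rim_walk[of 1 True 0 1] by simp
  moreover have "(vtx n True (0 + 1 * s True), vtx n (\<not> True) 0) \<in> E ^^ (x True + x (\<not> True))"
    by (rule corner_walk) simp
  moreover have "(vtx n (\<not> True) 0, vtx n True 0) \<in> E ^^ 1"
    using spoke_walk[of 0 0 False] by simp
  ultimately have "(u, u) \<in> E ^^ (1 + (x True + x (\<not> True)) + 1)"
    unfolding u_def by (meson relpow_trans)
  then have "(u, u) \<in> E ^^ ?g" by (cases c) (simp_all add: ac_simps)
  from net[OF this] obtain e where
    e: "\<bar>e\<bar> \<le> int ?g" "even (e + int ?g)" "vtx n c i = vtx n c (i + e * s c)"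
    using i by auto
  from e(3) have es: "[e * s c = 0] (mod int n)"
    unfolding vtx_eq_iff[OF n] by (simp add: cong_iff_dvd_diff)
  have es': "[int (nat \<bar>e\<bar>) * s c = 0] (mod int n)"
    by (rule cong_if_diff_multiple[OF es, where c = "sgn e"]) (simp add: abs_if sgn_if)
  have "(vtx n c 0, vtx n c 0) \<in> E ^^ nat \<bar>e\<bar>"
    by (rule rim_walk_to[of 1]) (use es' in \<open>simp_all add: cong_sym_eq\<close>)
  moreover have "odd (nat \<bar>e\<bar>)"
    using e(2) odd_length[of c] by (simp add: even_nat_iff)
  ultimately have "?g \<le> nat \<bar>e\<bar>" using minimal by blast
  then have "nat \<bar>e\<bar> = ?g" using e(1) by linarith
  then have g: "[int ?g * s c = 0] (mod int n)" using es' by simp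
  \<comment> \<open>Going \<open>?g\<close> steps along the rim closes up, so the two steps around
    \<open>j\<close> can be replaced by the remaining \<open>?g - 2\<close>.\<close>
  have "(vtx n c (j + s c), vtx n c (j - s c)) \<in> E ^^ (x c + x (\<not> c))" for j
  proof (rule rim_walk_to)
    show "[j - s c = j + s c + 1 * int (x c + x (\<not> c)) * s c] (mod int n)"
      by (rule cong_if_diff_multiple[OF g, where c = "- 1"]) (simp add: algebra_simps)
  qed simp
  then show False using c by (simp add: straight_def)
qed

text \<open>Every image vertex is fixed. If both sorts are straight, any one of them spreads by
  connectedness; otherwise one of the straight sort is needed to start from.\<close>

lemma idempotent_endomorphism_trivial:
  assumes f: "graph_endomorphism (generalized_petersen n k) f"
    and idem: "\<forall>v\<in>V. f (f v) = f v"
  shows "\<forall>v\<in>V. f v = v"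
proof -
  have "f (vtx n c j) = vtx n c j" for c j
  proof (cases "\<exists>b. \<not> straight b")
    case True
    then obtain c where c: "\<not> straight c" by blast
    define b where "b = (\<not> c)"
    have b: "\<not> straight (\<not> b)" using c by (simp add: b_def)
    then have x': "x (\<not> b) = 1" using straight_if_two_steps[of "\<not> b"] x[of "\<not> b"] by linarith
    \<comment> \<open>By parity, \<open>x b\<close> and \<open>x (\<not> b)\<close> cannot both be
      1.\<close>
    then have "2 \<le> x b" using odd_length[of b] x[of b] by (cases "x b = 1") auto
    then have "straight b" by (rule straight_if_two_steps)
    moreover obtain v i where "v \<in> V" "f v = vtx n b i"
      using image_meets_both_sorts[OF f b] by auto
    moreover from this have "f (vtx n b i) = vtx n b i" using idem by metis
    ultimately show ?thesis using fixed_vertex_spreads[OF f idem _ x'] by blast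
  next
    case False
    have v: "vtx n True 0 \<in> V" using pverts_petersen_iff[OF n] by blast
    then have "f (vtx n True 0) \<in> V" using f by (simp add: graph_endomorphism_def)
    then obtain b i where bi: "f (vtx n True 0) = vtx n b i" using pverts_petersen_iff[OF n] by blast
    have "vtx n c j \<in> {v. f v = v}"
    proof (rule connected)
      have "f (f (vtx n True 0)) = f (vtx n True 0)" using idem v by blast
      then show "vtx n b i \<in> {v. f v = v}" by (simp add: bi)
    next
      fix c j v assume "vtx n c j \<in> {v. f v = v}" "(vtx n c j, v) \<in> E"
      then show "v \<in> {v. f v = v}"
        using neighbours_fixed[OF f idem, of c j v] False by simp
    qed
    then show ?thesis by simp
  qed
  then show ?thesis using pverts_petersen_iff[OF n] by metis
qed

lemma core: "graph_core (generalized_petersen n k)"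
  using pair_graph_generalized_petersen[OF k] idempotent_endomorphism_trivial
  by (rule core_if_idempotents_trivial)

section \<open>From the minimal closed walk to a cycle\<close>

text \<open>A return after an odd number \<open>e\<close> of steps would itself be a shorter odd
  closed walk; for even \<open>e\<close>, cutting these steps out of the minimal walk would leave
  one.\<close>

lemma no_short_rim:
  assumes "0 < e" "e \<le> x b"
  shows "\<not> [int e * s b = 0] (mod int n)"
proof
  assume es: "[int e * s b = 0] (mod int n)"
  show False
  proof (cases "even e")
    case False
    have "(vtx n b 0, vtx n b 0) \<in> E ^^ e"
      by (rule rim_walk_to[of 1]) (use es in \<open>simp_all add: cong_sym_eq\<close>)
    then show False using minimal[OF False, of _ b] assms x[of "\<not> b"] by fastforce
  next
    case True
    let ?m = "1 * int (x b - e) * s b"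
    have "(vtx n b 0, vtx n b (0 + ?m)) \<in> E ^^ (x b - e)"
      by (rule rim_walk) simp
    moreover have "(vtx n b (0 + ?m), vtx n (\<not> b) (0 + ?m)) \<in> E ^^ 1"
      by (rule spoke_walk) simp
    moreover have "(vtx n (\<not> b) (0 + ?m), vtx n (\<not> b) 0) \<in> E ^^ x (\<not> b)"
    proof (rule rim_walk_to)
      have "[int (x b) * s b + int (x (\<not> b)) * s (\<not> b) - int e * s b = 0] (mod int n)"
        using cong_diff[OF closed[of b] es] by simp
      then show "[0 = 0 + ?m + 1 * int (x (\<not> b)) * s (\<not> b)] (mod int n)"
        by (rule cong_if_diff_multiple[where c = "- 1"])
          (use assms in \<open>simp add: of_nat_diff algebra_simps\<close>)
    qed simp
    moreover have "(vtx n (\<not> b) 0, vtx n b 0) \<in> E ^^ 1"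
      using spoke_walk[of 0 0 "\<not> b"] by simp
    ultimately have "(vtx n b 0, vtx n b 0) \<in> E ^^ (x b - e + 1 + x (\<not> b) + 1)"
      by (meson relpow_trans)
    moreover have "odd (x b - e + 1 + x (\<not> b) + 1)" using True odd_length[of b] assms by auto
    ultimately show False using minimal[of _ _ b] assms by fastforce
  qed
qed

lemma ex_shortest_odd_cycle_with_spoke:
  "\<exists>p. shortest_odd_cycle (generalized_petersen n k) p \<and> contains_spoke n p"
proof -
  define L where "L = x True + x False + 2"
  \<comment> \<open>Index \<open>x True + 1\<close> is the inner end of the first spoke, reached
    without changing the displacement; hence the \<open>- 1\<close>.\<close>
  define c where "c = (\<lambda>j. if j \<le> x True then vtx n True (int j * s True)
    else vtx n False (int (x True) * s True + int (j - x True - 1) * s False))"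
  define c' where "c' = (\<lambda>j. c (j mod L))"
  have distinct: "c i \<noteq> c j" if "i < j" "j < L" for i j
  proof
    assume eq: "c i = c j"
    show False
    proof (cases "j \<le> x True")
      case True
      then have "[int i * s True - int j * s True = 0] (mod int n)"
        using eq that by (simp add: c_def vtx_eq_iff[OF n] cong_iff_dvd_diff)
      then have "[int (j - i) * s True = 0] (mod int n)"
        by (rule cong_if_diff_multiple[where c = "- 1"])
          (use that in \<open>simp add: of_nat_diff algebra_simps\<close>)
      moreover have "0 < j - i" "j - i \<le> x True" using that True by auto
      ultimately show False using no_short_rim by blast
    next
      case False
      then have i: "\<not> i \<le> x True" using eq by (auto simp: c_def vtx_eq_iff[OF n])
      then have "[int (i - x True - 1) * s False - int (j - x True - 1) * s False = 0] (mod int n)"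
        using eq False by (simp add: c_def vtx_eq_iff[OF n] cong_iff_dvd_diff)
      then have "[int (j - i) * s False = 0] (mod int n)"
        by (rule cong_if_diff_multiple[where c = "- 1"])
          (use that i in \<open>simp add: of_nat_diff algebra_simps\<close>)
      moreover have "0 < j - i" "j - i \<le> x False" using that i by (auto simp: L_def)
      ultimately show False using no_short_rim by blast
    qed
  qed
  have arcs: "(c' i, c' (Suc i)) \<in> E" if "i < L" for i
  proof (cases "Suc i = L")
    case True
    \<comment> \<open>The last vertex has total displacement 0 modulo \<open>n\<close>, so the
      second spoke leads back to the start.\<close>
    then have "c' i = vtx n False (int (x True) * s True + int (x False) * s False)"
      by (auto simp: c'_def c_def L_def)
    also have "\<dots> = vtx n False 0" by (rule vtx_cong[OF closed_True])
    finally show ?thesis using True by (simp add: c'_def c_def arc_iff)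
  next
    case False
    then have eq: "c' i = c i" "c' (Suc i) = c (Suc i)" using that by (auto simp: c'_def)
    consider "i < x True" | "i = x True" | "x True < i" by linarith
    then show ?thesis
    proof cases
      case 1
      then show ?thesis unfolding eq by (simp add: c_def arc_iff algebra_simps)
    next
      case 2
      then show ?thesis unfolding eq by (simp add: c_def arc_iff)
    next
      case 3
      then have "int (Suc i - x True - 1) = int (i - x True - 1) + 1" by linarith
      with 3 show ?thesis unfolding eq by (simp add: c_def arc_iff algebra_simps)
    qed
  qed
  define p where "p = map (\<lambda>i. (c' i, c' (Suc i))) [0..<L]"
  have "pre_digraph.cycle (with_proj (generalized_petersen n k)) p"
    unfolding p_def
  proof (rule cycle_of_closed_sequence)
    show "pair_wf_digraph (generalized_petersen n k)"
      by (rule pair_wf_petersen[OF k])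
    show "inj_on c' {..<L}"
      by (rule linorder_inj_onI') (use distinct in \<open>auto simp: c'_def\<close>)
  qed (use arcs in \<open>simp_all add: c'_def L_def\<close>)
  moreover have len: "length p = L" by (simp add: p_def)
  moreover have "odd L" using odd_True by (simp add: L_def)
  moreover have "L \<le> length q"
    if "pre_digraph.cycle (with_proj (generalized_petersen n k)) q" "odd (length q)" for q
    using relpow_of_cycle[OF that(1)] minimal_True[OF that(2)] by (auto simp: L_def)
  moreover have "contains_spoke n p"
  proof -
    have "x True < L" by (simp add: L_def)
    then have "(c' (x True), c' (Suc (x True))) \<in> set p" by (auto simp: p_def)
    moreover have "(c' (x True), c' (Suc (x True))) \<in> spokes n"
      unfolding forward_arcs(3)[OF n] by (auto simp: c'_def c_def L_def)
    ultimately show ?thesis by (auto simp: contains_spoke_def)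
  qed
  ultimately show ?thesis by (auto simp: shortest_odd_cycle_def)
qed

end

section \<open>The multiplier\<close>

text \<open>The inner rims are \<open>d\<close> cycles of length \<open>m\<close>. Dividing the
  congruence by \<open>d\<close> shows that \<open>a\<close> inverts \<open>l\<close> modulo
  \<open>m\<close>.\<close>

locale multiplier =
  fixes n k d a m l :: nat
  assumes k: "0 < k" "2 * k < n"
    and d: "d = gcd n k"
    and a: "[a * k = d] (mod n)"
    and m: "m = n div d"
    and l: "l = k div d"
begin

lemma d0: "0 < d"
  using k d by simp

lemma n_eq: "n = m * d" and k_eq: "k = l * d"
proof -
  have "d dvd n" "d dvd k" by (simp_all add: d)
  then show "n = m * d" "k = l * d" by (simp_all add: m l)
qed

lemma n0: "0 < n"
  using k by simp

lemma m_gt_2: "2 < m"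
proof -
  have "0 < l" using k d0 by (simp add: k_eq)
  moreover have "2 * l < m" using k(2) d0 by (simp add: n_eq k_eq)
  ultimately show ?thesis by linarith
qed

lemma int_n: "int n = int m * int d" and int_k: "int k = int l * int d"
  using n_eq k_eq by (metis of_nat_mult)+

lemma inverse: "[int a * int l = 1] (mod int m)"
proof -
  have "[int (a * k) = int d] (mod int n)"
    using a by (simp only: cong_int_iff)
  then have "int m * int d dvd (int a * int l - 1) * int d"
    by (simp add: cong_iff_dvd_diff int_n int_k algebra_simps)
  then show ?thesis using d0 by (simp add: cong_iff_dvd_diff)
qed

lemma odd_if_even_m:
  assumes "even m"
  shows "odd a" and "odd l"
proof -
  have "int m dvd int a * int l - 1" using inverse by (simp add: cong_iff_dvd_diff)
  moreover have "2 dvd int m" using assms by simp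
  ultimately have "even (int a * int l - 1)" by (rule dvd_trans[rotated])
  then show "odd a" "odd l" by simp_all
qed

lemma mult_k_cong:
  assumes "[i = j] (mod int m)"
  shows "[int k * i = int k * j] (mod int n)"
proof -
  have "int m dvd i - j" using assms by (simp add: cong_iff_dvd_diff)
  then have "int m * int d dvd (i - j) * int d" by (rule mult_dvd_mono) simp
  then have "int n dvd int l * ((i - j) * int d)" unfolding int_n by (rule dvd_mult)
  then show ?thesis by (simp add: cong_iff_dvd_diff int_k algebra_simps)
qed

text \<open>As \<open>d\<close> divides both \<open>n\<close> and \<open>k\<close>, it divides
  \<open>x\<close>. Dividing by \<open>d\<close> leaves \<open>x' + l * y\<close>, a multiple of
  \<open>m\<close>; multiplying by the inverse \<open>a\<close> of \<open>l\<close> isolates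
  \<open>y\<close>.\<close>

lemma reduce:
  assumes xy: "[x + int k * y = 0] (mod int n)" and A: "[A = int a] (mod int m)"
  shows "\<exists>x'. x = int d * x' \<and> [y + A * x' = 0] (mod int m)"
proof -
  have dvd: "int m * int d dvd x + int l * int d * y"
    using xy by (simp add: cong_0_iff int_n int_k)
  then have "int d dvd x + int l * int d * y" by (rule dvd_mult_right)
  then have "int d dvd x" by (simp add: dvd_add_left_iff)
  then obtain x' where x': "x = int d * x'" by blast
  have "int m * int d dvd (x' + int l * y) * int d"
    using dvd by (simp add: x' algebra_simps)
  then have "int m dvd x' + int l * y" using d0 by simp
  then have "int m dvd int a * (x' + int l * y)" by (rule dvd_mult)
  then have "[int a * x' + int a * int l * y = 0] (mod int m)"
    by (simp add: cong_0_iff algebra_simps)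
  moreover have "[A * x' + 1 * y = int a * x' + int a * int l * y] (mod int m)"
    using A inverse by (intro cong_add cong_mult cong_refl) (simp_all add: cong_sym)
  ultimately have "[A * x' + 1 * y = 0] (mod int m)" by (rule cong_trans[rotated])
  then show ?thesis using x' by (auto simp: add.commute)
qed

lemma reduce_inner: "[int k * y = 0] (mod int n) \<Longrightarrow> int m dvd y"
  using reduce[of 0 y "int a"] d0 by (auto simp: cong_0_iff)

section \<open>The case in which (c) fails\<close>

lemma ex_odd_rim_cycle:
  assumes "odd m"
  shows "\<exists>p. pre_digraph.cycle (with_proj (generalized_petersen n k)) p \<and> length p = m"
proof -
  define c where "c = (\<lambda>j. vtx n False (int k * int j))"
  have "pre_digraph.cycle (with_proj (generalized_petersen n k))
    (map (\<lambda>i. (c i, c (Suc i))) [0..<m])"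
  proof (rule cycle_of_closed_sequence)
    show "pair_wf_digraph (generalized_petersen n k)"
      by (rule pair_wf_petersen[OF k])
    show "inj_on c {..<m}"
    proof (rule inj_onI)
      fix i j assume ij: "i \<in> {..<m}" "j \<in> {..<m}" "c i = c j"
      then have "[int k * (int i - int j) = 0] (mod int n)"
        by (simp add: c_def vtx_eq_iff[OF n0] cong_iff_dvd_diff algebra_simps)
      then have "int m dvd int i - int j" by (rule reduce_inner)
      then have "int i - int j = 0" using dvd_imp_le_int[of "int i - int j" "int m"] ij by fastforce
      then show "i = j" by simp
    qed
    show "c m = c 0"
      using mult_k_cong[of "int m" 0] by (auto simp: c_def cong_0_iff intro: vtx_cong)
    show "(c i, c (Suc i)) \<in> parcs (generalized_petersen n k)" for i
      by (simp add: c_def arc_petersen_iff[OF n0] step_def algebra_simps)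
  qed (use m_gt_2 in simp)
  then show ?thesis by (intro exI conjI) auto
qed

text \<open>Delete the spoke and reduce the displacement of the rest. As \<open>A\<close> has the
  parity of \<open>d\<close>, \<open>y + A * x'\<close> has the odd parity of \<open>x + y\<close>;
  it is thus a nonzero multiple of \<open>m\<close>, too large for a cycle no longer than a
  rim.\<close>

lemma no_shortest_odd_cycle_with_spoke:
  assumes "odd m" and A: "[A = int a] (mod int m)" "\<bar>A\<bar> \<le> int d" "even (A - int d)"
    and p: "shortest_odd_cycle (generalized_petersen n k) p"
  shows "\<not> contains_spoke n p"
proof
  assume "contains_spoke n p"
  then obtain e where e: "e \<in> set p" "e \<in> spokes n \<union> (spokes n)\<inverse>"
    by (auto simp: contains_spoke_def)
  then obtain i where "e = (vtx n True i, vtx n (\<not> True) i) \<or> e = (vtx n False i, vtx n (\<not> False) i)"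
    unfolding forward_arcs(3)[OF n0] by auto
  then obtain b where bi: "e = (vtx n b i, vtx n (\<not> b) i)" by blast
  have len: "odd (length p)" "length p \<le> m"
    using p ex_odd_rim_cycle[OF assms(1)] assms(1) by (auto simp: shortest_odd_cycle_def)
  have "(vtx n (\<not> b) i, vtx n b i) \<in> parcs (generalized_petersen n k) ^^ (length p - 1)"
    using relpow_of_cycle_through[OF _ e(1)] p by (auto simp: shortest_odd_cycle_def bi)
  from closed_net_displacement[OF n0 this] obtain x y t where
    xy0: "[x + int k * y = 0] (mod int n)"
    and bound: "\<bar>x\<bar> + \<bar>y\<bar> + int t \<le> int (length p - 1)"
    and parity: "even (x + y + int t + int (length p - 1))" "odd t"
    by auto
  have xy: "odd (x + y)" using parity len(1) by auto
  obtain x' where x': "x = int d * x'" "[y + A * x' = 0] (mod int m)"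
    using reduce[OF xy0 A(1)] by blast
  have "even (y + A * x' - (x + y))"
  proof -
    have "y + A * x' - (x + y) = (A - int d) * x'" by (simp add: x'(1) algebra_simps)
    then show ?thesis using A(3) by simp
  qed
  then have "y + A * x' \<noteq> 0" using xy by (metis diff_0 even_minus)
  moreover have "int m dvd y + A * x'" using x'(2) by (simp add: cong_0_iff)
  ultimately have "\<bar>int m\<bar> \<le> \<bar>y + A * x'\<bar>" by (rule dvd_imp_le_int)
  then have "int m \<le> \<bar>y + A * x'\<bar>" by simp
  also have "\<dots> \<le> \<bar>y\<bar> + \<bar>A\<bar> * \<bar>x'\<bar>" by (metis abs_mult abs_triangle_ineq)
  also have "\<dots> \<le> \<bar>y\<bar> + \<bar>x\<bar>" using A(2) by (simp add: x'(1) abs_mult mult_right_mono)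
  also have "\<dots> < int m" using bound len(2) parity(2) m_gt_2 by (cases t) auto
  finally show False by simp
qed

text \<open>The graph is mapped to the rim of \<open>v\<^sub>0\<close>: \<open>v\<^sub>i\<close> goes to position \<open>phi i\<close> and \<open>u\<^sub>i\<close> to position
  \<open>phi i + 1\<close>. Moving \<open>d\<close> steps along the outer rim must change the position by \<open>a\<close> modulo \<open>m\<close>,
  which \<open>d\<close> steps of \<open>+1\<close> or \<open>-1\<close> can do because \<open>a\<close> has a representative \<open>A\<close> modulo \<open>m\<close> with
  \<open>\<bar>A\<bar> \<le> d\<close> and the parity of \<open>d\<close>.\<close>

lemma not_core:
  assumes A: "[A = int a] (mod int m)" "\<bar>A\<bar> \<le> int d" "even (A - int d)"
  shows "\<not> graph_core (generalized_petersen n k)"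
proof -
  have "even (int d + A)" using A(3) by (simp add: add.commute)
  then obtain h where h: "int d + A = 2 * h" by blast
  \<comment> \<open>Climb \<open>h\<close> steps and descend \<open>d - h\<close>, a net change of
    \<open>2 * h - d = A\<close>; the bound on \<open>A\<close> gives
    \<open>0 \<le> h \<le> d\<close>.\<close>
  define psi where "psi = (\<lambda>r. if r \<le> h then r else 2 * h - r)"
  define phi where "phi = (\<lambda>i. (i div int d) * A + psi (i mod int d))"
  have psi: "psi 0 = 0" "psi (int d) = A" using h A(2) by (auto simp: psi_def)
  have psi_step: "psi (r + 1) = psi r + 1 \<or> psi (r + 1) = psi r - 1" for r
    by (auto simp: psi_def)
  have phi_step: "phi (i + 1) = phi i + 1 \<or> phi (i + 1) = phi i - 1" for i
  proof -
    define q r where "q = i div int d" and "r = i mod int d"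
    have r: "0 \<le> r" "r < int d" using d0 by (simp_all add: r_def)
    have i: "i = q * int d + r" by (simp add: q_def r_def)
    show ?thesis
    proof (cases "r + 1 = int d")
      case True
      then have i1: "i + 1 = (q + 1) * int d" by (simp add: i algebra_simps)
      have "phi (i + 1) = (q + 1) * A" unfolding i1 using d0 by (simp add: phi_def psi)
      then have "phi (i + 1) = q * A + psi (r + 1)"
        unfolding True psi(2) by (simp add: algebra_simps)
      moreover have "phi i = q * A + psi r" by (simp add: phi_def q_def r_def)
      ultimately show ?thesis using psi_step[of r] by auto
    next
      case False
      have "(i + 1) div int d = q" "(i + 1) mod int d = r + 1"
        using r False by (auto simp: i add.assoc intro!: div_pos_pos_trivial mod_pos_pos_trivial)
      then have "phi (i + 1) = q * A + psi (r + 1)" by (simp add: phi_def)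
      moreover have "phi i = q * A + psi r" by (simp add: phi_def q_def r_def)
      ultimately show ?thesis using psi_step[of r] by auto
    qed
  qed
  have phi_shift: "phi (i + q * int d) = phi i + q * A" for i q
    using d0 by (simp add: phi_def algebra_simps)
  \<comment> \<open>An inner arc shifts the index by \<open>l * d\<close>, hence \<open>phi\<close>
    by \<open>l * A\<close>, which is 1 modulo \<open>m\<close>.\<close>
  have phi_k: "[int k * phi (i + int k) = int k * (phi i + 1)] (mod int n)" for i
  proof (rule mult_k_cong)
    have "[int l * A = int l * int a] (mod int m)" using A(1) by (rule cong_mult[OF cong_refl])
    then have "[int l * A = 1] (mod int m)"
      using inverse by (metis cong_trans mult.commute)
    then show "[phi (i + int k) = phi i + 1] (mod int m)"
      unfolding int_k phi_shift by (rule cong_add[OF cong_refl])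
  qed
  define val where "val = (\<lambda>b i. phi i + (if b then 1 else 0 :: int))"
  define f where "f = (\<lambda>v. case v of Outer i \<Rightarrow> vtx n False (int k * val True (int i))
    | Inner i \<Rightarrow> vtx n False (int k * val False (int i)))"
  have f: "f (vtx n b i) = vtx n False (int k * val b i)" for b i
  proof -
    \<comment> \<open>Well-definedness: adding \<open>n = m * d\<close> to the index changes
      \<open>phi\<close> by a multiple of \<open>m\<close>.\<close>
    have "i = i mod int n + (i div int n * int m) * int d"
      by (simp add: mult.assoc flip: int_n)
    then have "phi i = phi (i mod int n) + (i div int n * int m) * A"
      using phi_shift by metis
    then have "[val b (i mod int n) = val b i] (mod int m)"
      by (simp add: val_def cong_iff_dvd_diff)
    then have "vtx n False (int k * val b (i mod int n)) = vtx n False (int k * val b i)"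
      by (intro vtx_cong mult_k_cong)
    moreover have "f (vtx n b i) = vtx n False (int k * val b (i mod int n))"
      using n0 by (cases b) (simp_all add: f_def vtx_def)
    ultimately show ?thesis by simp
  qed
  have nbr: "(vtx n False (int k * i), vtx n False (int k * j)) \<in> parcs (generalized_petersen n k)"
    if "[int k * j = int k * (i + 1)] (mod int n) \<or> [int k * i = int k * (j + 1)] (mod int n)" for i j
  proof -
    have arc: "(vtx n False (int k * i), vtx n False (int k * (i + 1)))
      \<in> parcs (generalized_petersen n k)" for i
      by (simp add: arc_petersen_iff[OF n0] step_def algebra_simps)
    from that show ?thesis
    proof
      assume "[int k * j = int k * (i + 1)] (mod int n)"
      from vtx_cong[OF this] show ?thesis using arc[of i] by simp
    next
      assume "[int k * i = int k * (j + 1)] (mod int n)"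
      from vtx_cong[OF this] show ?thesis using symD[OF sym_parcs_petersen arc[of j]] by simp
    qed
  qed
  have arcs: "(f u, f v) \<in> parcs (generalized_petersen n k)"
    if "(u, v) \<in> parcs (generalized_petersen n k)" for u v
  proof -
    have "u \<in> pverts (generalized_petersen n k)"
      using pair_wf_digraph.in_arcsD1[OF pair_wf_petersen[OF k] that] .
    then obtain b i where u: "u = vtx n b i" using pverts_petersen_iff[OF n0] by blast
    from that consider "v = vtx n b (i + step k b)" | "v = vtx n b (i - step k b)"
      | "v = vtx n (\<not> b) i"
      unfolding u arc_petersen_iff[OF n0] by blast
    then show ?thesis
    proof cases
      case 1
      show ?thesis unfolding u 1 f
        by (rule nbr) (use phi_step[of i] phi_k[of i] in
            \<open>cases b; auto simp: val_def step_def add.commute cong_sym_eq\<close>)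
    next
      case 2
      show ?thesis unfolding u 2 f
        by (rule nbr) (use phi_step[of "i - 1"] phi_k[of "i - int k"] in
            \<open>cases b; auto simp: val_def step_def add.commute cong_sym_eq\<close>)
    next
      case 3
      show ?thesis unfolding u 3 f
        by (rule nbr) (cases b; simp add: val_def)
    qed
  qed
  have inV: "vtx n b i \<in> pverts (generalized_petersen n k)" for b i
    using pverts_petersen_iff[OF n0] by blast
  have "graph_endomorphism (generalized_petersen n k) f"
    using arcs f inV pverts_petersen_iff[OF n0, of _ k] unfolding graph_endomorphism_def by metis
  moreover have "\<not> graph_automorphism (generalized_petersen n k) f"
  proof
    assume "graph_automorphism (generalized_petersen n k) f"
    \<comment> \<open>The image contains inner vertices only, so \<open>f\<close> is not
      surjective.\<close>
    then have "vtx n True 0 \<in> f ` pverts (generalized_petersen n k)"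
      using inV by (simp add: graph_automorphism_def bij_betw_def)
    then obtain v where v: "v \<in> pverts (generalized_petersen n k)" "vtx n True 0 = f v" by blast
    then obtain b i where "v = vtx n b i" using pverts_petersen_iff[OF n0] by blast
    then show False using v(2) by (simp add: f vtx_eq_iff[OF n0])
  qed
  ultimately show ?thesis by (auto simp: graph_core_def)
qed

section \<open>The case in which (c) holds\<close>

text \<open>Among solutions of the closing congruence with nonzero entries and odd sum, take one of
  least total size. An odd closed walk with nonzero displacements is no shorter, as it needs two
  spokes; any other has length at least \<open>m\<close>, with \<open>m\<close> odd, and the last
  hypothesis applies.\<close>

lemma ex_minimal_spoke_walk:
  assumes "x0 \<noteq> 0" "y0 \<noteq> 0" "[x0 + int k * y0 = 0] (mod int n)" "odd (x0 + y0)"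
    and "odd m \<Longrightarrow> \<bar>x0\<bar> + \<bar>y0\<bar> + 2 \<le> int m"
  shows "\<exists>s x. minimal_spoke_walk n k s x"
proof -
  let ?P = "\<lambda>(x, y). x \<noteq> 0 \<and> y \<noteq> 0 \<and> [x + int k * y = 0] (mod int n) \<and> odd (x + y)"
  let ?w = "\<lambda>(x, y). nat (\<bar>x\<bar> + \<bar>y\<bar>)"
  have "\<exists>z. ?P z \<and> (\<forall>z'. ?P z' \<longrightarrow> ?w z \<le> ?w z')"
    by (rule ex_has_least_nat[of ?P "(x0, y0)"]) (use assms in simp)
  then obtain X Y where XY: "?P (X, Y)" and least: "\<And>z'. ?P z' \<Longrightarrow> ?w (X, Y) \<le> ?w z'" by blast
  have le: "\<bar>X\<bar> + \<bar>Y\<bar> \<le> \<bar>x\<bar> + \<bar>y\<bar>" if "?P (x, y)" for x y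
    using least[OF that] by (simp add: nat_le_iff)
  have m_le: "\<bar>X\<bar> + \<bar>Y\<bar> + 2 \<le> int m" if "odd m"
    using le[of x0 y0] assms that by fastforce
  define s where "s = (\<lambda>b. if b then sgn X else sgn Y * int k)"
  define x where "x = (\<lambda>b. nat (if b then \<bar>X\<bar> else \<bar>Y\<bar>))"
  have "minimal_spoke_walk n k s x"
  proof
    show "s b = step k b \<or> s b = - step k b" for b
      using XY by (auto simp: s_def step_def sgn_if)
    show "0 < x b" for b using XY by (auto simp: x_def)
    have "int (x True) * s True + int (x False) * s False = X + int k * Y"
      using abs_sgn[of X] by (simp add: x_def s_def abs_mult_sgn flip: mult.assoc)
    then show "[int (x True) * s True + int (x False) * s False = 0] (mod int n)"
      using XY by simp
    show "odd (x True + x False)" using XY by (simp add: x_def even_nat_iff)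
    fix L v
    assume L: "odd L" "(v, v) \<in> parcs (generalized_petersen n k) ^^ L"
    obtain L' where "L = Suc L'" using L(1) by (cases L) auto
    then obtain w where "(w, v) \<in> parcs (generalized_petersen n k)" using L(2) by auto
    then have "v \<in> pverts (generalized_petersen n k)"
      by (rule pair_wf_digraph.in_arcsD2[OF pair_wf_petersen[OF k]])
    then obtain b i where v: "v = vtx n b i" using pverts_petersen_iff[OF n0] by blast
    from closed_net_displacement[OF n0 L(2)[unfolded v]] obtain x' y' t where
      xy0: "[x' + int k * y' = 0] (mod int n)"
      and bound: "\<bar>x'\<bar> + \<bar>y'\<bar> + int t \<le> int L"
      and parity: "even (x' + y' + int t + int L)" and t: "even t"
      and t0: "t = 0 \<longrightarrow> (if b then y' = 0 else x' = 0)"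
      by blast
    have odd: "odd (x' + y')" using parity t L(1) by auto
    have "\<bar>X\<bar> + \<bar>Y\<bar> + 2 \<le> int L"
    proof (cases "x' = 0 \<or> y' = 0")
      case True
      have "int m dvd x' + y'"
      proof (cases "x' = 0")
        case True
        then show ?thesis using reduce_inner[of y'] xy0 by simp
      next
        case False
        then have "int n dvd x'" using xy0 \<open>x' = 0 \<or> y' = 0\<close> by (simp add: cong_0_iff)
        then have "int m dvd x'" using int_n by (metis dvd_mult_left)
        then show ?thesis using False True by simp
      qed
      moreover from this have "odd m" using odd by (meson dvd_trans even_of_nat)
      moreover have "x' + y' \<noteq> 0" using odd by (metis dvd_0_right)
      ultimately have "\<bar>int m\<bar> \<le> \<bar>x' + y'\<bar>" "odd m" using dvd_imp_le_int by blast+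
      then show ?thesis using m_le bound by simp
    next
      case False
      then have "t \<noteq> 0" using t0 by (auto split: if_splits)
      then have "2 \<le> t" using t by (cases "t = 1") auto
      moreover have "\<bar>X\<bar> + \<bar>Y\<bar> \<le> \<bar>x'\<bar> + \<bar>y'\<bar>" using False xy0 odd by (intro le) simp
      ultimately show ?thesis using bound by linarith
    qed
    then show "x True + x False + 2 \<le> L" by (simp add: x_def)
  qed (use k in auto)
  then show ?thesis by blast
qed

text \<open>For odd \<open>d\<close>, \<open>k\<close> is odd and \<open>n\<close> even, so index
  parity, swapped on the inner vertices, is a proper 2-colouring.\<close>

lemma even_d_if_not_bipartite:
  assumes "even m" "\<not> bipartite (generalized_petersen n k)"
  shows "even d"
proof (rule ccontr)
  assume "odd d"
  with odd_if_even_m(2)[OF assms(1)] have "odd k" unfolding k_eq by simp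
  have "even n" using assms(1) unfolding n_eq by simp
  then have par: "even (i mod n) \<longleftrightarrow> even i" for i by (simp add: dvd_mod_iff)
  let ?A = "{Outer i | i. i < n \<and> even i} \<union> {Inner i | i. i < n \<and> odd i}"
  let ?B = "{Outer i | i. i < n \<and> odd i} \<union> {Inner i | i. i < n \<and> even i}"
  have "?A \<union> ?B = pverts (generalized_petersen n k)" by (auto simp: generalized_petersen_def)
  moreover have "?A \<inter> ?B = {}" by auto
  moreover have "\<forall>(x, y) \<in> parcs (generalized_petersen n k). x \<in> ?A \<and> y \<in> ?B \<or> x \<in> ?B \<and> y \<in> ?A"
    using n0 \<open>odd k\<close>
    by (auto simp: generalized_petersen_def Let_def outer_rim_def inner_rims_def spokes_def par
        simp del: add_Suc_right add_Suc)
  ultimately have "bipartite (generalized_petersen n k)"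
    unfolding bipartite_def by (intro exI[of _ ?A] exI[of _ ?B] conjI)
  then show False using assms(2) by simp
qed

end

theorem theorem2p1:
  fixes n k d a :: nat
  assumes "0 < k" and "2 * k < n"
    and "\<not> bipartite (generalized_petersen n k)"
    and "d = gcd n k"
    and "0 < a" and "a < n div d" and "[a * k = d] (mod n)"
  shows "(graph_core (generalized_petersen n k) \<longleftrightarrow>
            (\<exists>p. shortest_odd_cycle (generalized_petersen n k) p \<and> contains_spoke n p))
       \<and> ((\<exists>p. shortest_odd_cycle (generalized_petersen n k) p \<and> contains_spoke n p) \<longleftrightarrow>
            even (n div d)
            \<or> (even (a + d) \<and> a \<ge> d + 2)
            \<or> (odd (a + d) \<and> a + d + 2 \<le> n div d))"
    (is "(?core \<longleftrightarrow> ?spoke) \<and> (?spoke \<longleftrightarrow> ?arith)")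
proof -
  define m l where "m = n div d" and "l = k div d"
  interpret multiplier n k d a m l using assms m_def l_def by unfold_locales
  have am: "a < m" and arith: "?arith \<longleftrightarrow> even m \<or> (even (a + d) \<and> a \<ge> d + 2)
      \<or> (odd (a + d) \<and> a + d + 2 \<le> m)"
    using assms by (simp_all add: m_def)
  \<comment> \<open>The basic solution is \<open>(d, - a)\<close>, whose sum has the parity of
    \<open>a + d\<close>.\<close>
  have ak: "[int d - int k * int a = 0] (mod int n)"
  proof -
    have "[int (a * k) = int d] (mod int n)" using assms(7) by (simp only: cong_int_iff)
    then show ?thesis by (simp add: cong_iff_dvd_diff dvd_diff_commute mult.commute)
  qed
  show ?thesis
  proof (cases ?arith)
    case True
    have "\<exists>x0 y0. x0 \<noteq> 0 \<and> y0 \<noteq> 0 \<and> [x0 + int k * y0 = 0] (mod int n) \<and> odd (x0 + y0)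
      \<and> (odd m \<longrightarrow> \<bar>x0\<bar> + \<bar>y0\<bar> + 2 \<le> int m)"
    proof (cases "odd m \<and> even (a + d)")
      case c2: True
      then have "d + 2 \<le> a" using True arith by auto
      \<comment> \<open>Replacing \<open>- a\<close> by \<open>m - a\<close> makes the sum odd, and
        the required bound by \<open>m\<close> becomes \<open>d + 2 \<le> a\<close>.\<close>
      have "[int d + int k * (int m - int a) = 0] (mod int n)"
        using cong_add[OF ak mult_k_cong[of "int m" 0]]
        by (simp add: cong_0_iff algebra_simps)
      then show ?thesis using c2 \<open>d + 2 \<le> a\<close> am d0
        by (intro exI[of _ "int d"] exI[of _ "int m - int a"]) auto
    next
      case False
      have "odd (a + d)"
      proof (cases "even m")
        case True
        then show ?thesis
          using odd_if_even_m(1) even_d_if_not_bipartite[OF _ assms(3)] by simp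
      qed (use False in simp)
      then show ?thesis using ak assms(5) True arith d0
        by (intro exI[of _ "int d"] exI[of _ "- int a"]) auto
    qed
    then obtain s x where "minimal_spoke_walk n k s x" using ex_minimal_spoke_walk by blast
    then interpret minimal_spoke_walk n k s x .
    show ?thesis using core ex_shortest_odd_cycle_with_spoke True by blast
  next
    case False
    then have odd: "odd m" using arith by blast
    \<comment> \<open>The representative is \<open>a\<close> or \<open>a - m\<close>, according to
      the parity of \<open>a + d\<close>; parity also excludes the borderline values
      \<open>a = d + 1\<close> and \<open>a + d + 1 = m\<close>.\<close>
    have "\<exists>A. [A = int a] (mod int m) \<and> \<bar>A\<bar> \<le> int d \<and> even (A - int d)"
    proof (cases "even (a + d)")
      case True
      then have "a \<le> d" using False arith by (cases "a = d + 1") auto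
      then show ?thesis using True by (intro exI[of _ "int a"]) auto
    next
      case odd': False
      then have "\<not> a + d + 2 \<le> m" using False arith by blast
      moreover have "a + d + 1 \<noteq> m" using odd odd' by auto
      ultimately have "m \<le> a + d" by linarith
      then show ?thesis using odd odd' am
        by (intro exI[of _ "int a - int m"]) (auto simp: cong_iff_dvd_diff)
    qed
    then obtain A where A: "[A = int a] (mod int m)" "\<bar>A\<bar> \<le> int d" "even (A - int d)" by blast
    show ?thesis
      using not_core[OF A] no_shortest_odd_cycle_with_spoke[OF odd A] False by blast
  qed
qed

end
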